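(* Let $E$ be a truncation closed differential subfield of $\mathbf k((t^\Gamma))$. Let $\widehat E$ be the smallest differential subfield of $\mathbf k((t^\Gamma))$ that contains $E$ and is closed under $(I-a\partial)^{-1}$ for all $a\in\widehat E$ with $a\prec 1$. Then $\widehat E$ is truncation closed.
   Context: $\mathbf k$ is a differential field (characteristic $0$, derivation $\partial$, possibly trivial), $\Gamma$ an ordered abelian group, and $c:\Gamma\to\mathbf k$ an additive map. $\mathbf k((t^\Gamma))$ is the Hahn field of series $f=\sum_\gamma f_\gamma t^\gamma$ ($f_\gamma\in\mathbf k$) with well-ordered support $\operatorname{supp}f=\{\gamma:f_\gamma\ne0\}$; $f\prec 1$ means $\operatorname{supp}f\subseteq\Gamma^{>0}$. It is equipped with the derivation $\partial\big(\sum_\gamma f_\gamma t^\gamma\big)=\sum_\gamma\big(\partial(f_\gamma)+f_\gamma c(\gamma)\big)t^\gamma$. For $f$ and $\gamma_0\in\Gamma$ the truncation is $f|_{\gamma_0}=\sum_{\gamma<\gamma_0}f_\gamma t^\gamma$; a subset is truncation closed if it contains all truncations of its elements. $I$ is the identity map; for $a\prec1$ the operator $I-a\partial:y\mapsto y-ay'$ is a bijection of $\mathbf k((t^\Gamma))$, so $(I-a\partial)^{-1}(f)$ is the unique $y$ with $y-ay'=f$. *)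

theory Defs
  imports Complex_Main
begin

section \<open>Well-ordered subsets of a linear order\<close>

lemma wfp_on_less_iff:
  fixes A :: "'g::linorder set"
  shows "wfp_on A (<) \<longleftrightarrow> (\<forall>S\<subseteq>A. S \<noteq> {} \<longrightarrow> (\<exists>m\<in>S. \<forall>x\<in>S. m \<le> x))"
  unfolding wfp_on_iff_ex_minimal by (meson not_less)

lemma wfp_on_lessE:
  fixes A :: "'g::linorder set"
  assumes "wfp_on A (<)" "S \<subseteq> A" "S \<noteq> {}"
  obtains m where "m \<in> S" "\<And>x. x \<in> S \<Longrightarrow> m \<le> x"
  using assms unfolding wfp_on_less_iff by meson

lemma wfp_on_less_Un:
  fixes A :: "'g::linorder set"
  assumes A: "wfp_on A (<)" and B: "wfp_on B (<)"
  shows "wfp_on (A \<union> B) (<)"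
  unfolding wfp_on_less_iff
proof (intro allI impI)
  fix S assume S: "S \<subseteq> A \<union> B" "S \<noteq> {}"
  consider "S \<inter> A = {}" | "S \<inter> B = {}" | "S \<inter> A \<noteq> {}" "S \<inter> B \<noteq> {}" by blast
  then show "\<exists>m\<in>S. \<forall>x\<in>S. m \<le> x"
  proof cases
    case 1
    then have "S \<subseteq> B" using S by blast
    then show ?thesis using B S by (meson wfp_on_less_iff)
  next
    case 2
    then have "S \<subseteq> A" using S by blast
    then show ?thesis using A S by (meson wfp_on_less_iff)
  next
    case 3
    obtain m where m: "m \<in> S \<inter> A" "\<And>x. x \<in> S \<inter> A \<Longrightarrow> m \<le> x"
      using wfp_on_lessE[OF A _ 3(1)] by blast
    obtain n where n: "n \<in> S \<inter> B" "\<And>x. x \<in> S \<inter> B \<Longrightarrow> n \<le> x"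
      using wfp_on_lessE[OF B _ 3(2)] by blast
    have "min m n \<in> S" using m(1) n(1) by (auto simp: min_def)
    moreover have "\<forall>x\<in>S. min m n \<le> x" using m(2) n(2) S(1) by (auto simp: min_le_iff_disj)
    ultimately show ?thesis by blast
  qed
qed

lemma finite_if_wfp_on_less_greater:
  fixes X :: "'g::linorder set"
  assumes L: "wfp_on X (<)" and G: "\<And>S. S \<subseteq> X \<Longrightarrow> S \<noteq> {} \<Longrightarrow> \<exists>m\<in>S. \<forall>x\<in>S. x \<le> m"
  shows "finite X"
proof -
  have seg: "finite {y\<in>X. y < x}" if "x \<in> X" for x
    using L that
  proof (induction rule: wfp_on_induct)
    case in_set
    show ?case using that .
  next
    case (less x)
    show ?case
    proof (cases "{y\<in>X. y < x} = {}")
      case False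
      obtain m where m: "m \<in> X" "m < x" "\<And>y. y \<in> X \<Longrightarrow> y < x \<Longrightarrow> y \<le> m"
        using G[OF _ False] by blast
      have "{y\<in>X. y < x} \<subseteq> insert m {y\<in>X. y < m}" using m(3) by force
      then show ?thesis using less m by (meson finite_insert finite_subset)
    qed (metis finite.emptyI)
  qed
  show ?thesis
  proof (cases "X = {}")
    case False
    obtain m where m: "m \<in> X" "\<And>y. y \<in> X \<Longrightarrow> y \<le> m"
      using G[OF order_refl False] by blast
    have "X \<subseteq> insert m {y\<in>X. y < m}" using m(2) by force
    then show ?thesis using seg[OF m(1)] by (meson finite_insert finite_subset)
  qed simp
qed

lemma wfp_on_less_sums:
  fixes A :: "'g::linordered_ab_group_add set"
  assumes A: "wfp_on A (<)" and B: "wfp_on B (<)"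
  shows "wfp_on {a + b |a b. a \<in> A \<and> b \<in> B} (<)"
proof -
  define P where "P b \<longleftrightarrow> (\<forall>T. T \<noteq> {} \<and> T \<subseteq> {a + b' |a b'. a \<in> A \<and> b' \<in> B \<and> b' < b}
      \<longrightarrow> (\<exists>m\<in>T. \<forall>x\<in>T. m \<le> x))" for b
  have key: "\<exists>m\<in>T. \<forall>x\<in>T. m \<le> x"
    if T: "T \<noteq> {}" "T \<subseteq> {a + b' |a b'. a \<in> A \<and> b' \<in> B'}" and B': "B' \<subseteq> B"
      and IH: "\<And>b. b \<in> B' \<Longrightarrow> P b" for T B'
  proof -
    have ne: "{a\<in>A. \<exists>b\<in>B'. a + b \<in> T} \<noteq> {}" using T by blast
    obtain a1 where a1: "a1 \<in> {a\<in>A. \<exists>b\<in>B'. a + b \<in> T}"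
      "\<And>a. a \<in> {a\<in>A. \<exists>b\<in>B'. a + b \<in> T} \<Longrightarrow> a1 \<le> a"
      using wfp_on_lessE[OF A _ ne] by blast
    then obtain b1 where b1: "b1 \<in> B'" "a1 + b1 \<in> T" by blast
    define T1 where "T1 = T \<inter> {a + b' |a b'. a \<in> A \<and> b' \<in> B \<and> b' < b1}"
    have rest: "a1 + b1 \<le> x" if x: "x \<in> T" "x \<notin> T1" for x
    proof -
      obtain a b where ab: "x = a + b" "a \<in> A" "b \<in> B'" using T x by blast
      then have "\<not> b < b1" using x B' unfolding T1_def by blast
      moreover have "a1 \<le> a" using a1(2)[of a] ab x by blast
      ultimately show ?thesis using ab by (simp add: add_mono)
    qed
    show ?thesis
    proof (cases "T1 = {}")
      case True
      then show ?thesis using rest b1 by blast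
    next
      case False
      then obtain m where m: "m \<in> T1" "\<And>x. x \<in> T1 \<Longrightarrow> m \<le> x"
        using IH[OF b1(1), unfolded P_def, rule_format, of T1] unfolding T1_def by blast
      have "min m (a1 + b1) \<in> T" using m(1) b1 T1_def by (auto simp: min_def)
      moreover have "\<forall>x\<in>T. min m (a1 + b1) \<le> x"
        using m(2) rest by (auto simp: min_le_iff_disj)
      ultimately show ?thesis by blast
    qed
  qed
  have P: "P b" if "b \<in> B" for b
    using B that
  proof (induction rule: wfp_on_induct)
    case in_set
    show ?case using that .
  next
    case (less b)
    show ?case
      unfolding P_def
    proof (intro allI impI, elim conjE)
      fix T assume "T \<noteq> {}" "T \<subseteq> {a + b' |a b'. a \<in> A \<and> b' \<in> B \<and> b' < b}"
      then show "\<exists>m\<in>T. \<forall>x\<in>T. m \<le> x"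
        using less by (intro key[of T "{b'\<in>B. b' < b}"]) auto
    qed
  qed
  show ?thesis
    unfolding wfp_on_less_iff using key[of _ B] P by blast
qed

lemma finite_sum_decompositions:
  fixes A :: "'g::linordered_ab_group_add set"
  assumes A: "wfp_on A (<)" and B: "wfp_on B (<)"
  shows "finite {(a, b). a \<in> A \<and> b \<in> B \<and> a + b = s}"
proof -
  let ?X = "{a\<in>A. s - a \<in> B}"
  have "finite ?X"
  proof (rule finite_if_wfp_on_less_greater)
    show "wfp_on ?X (<)" using A by (rule wfp_on_subset) blast
    fix S assume S: "S \<subseteq> ?X" "S \<noteq> {}"
    have "(\<lambda>a. s - a) ` S \<subseteq> B" "(\<lambda>a. s - a) ` S \<noteq> {}" using S by auto
    then obtain m where "m \<in> (\<lambda>a. s - a) ` S" "\<And>x. x \<in> (\<lambda>a. s - a) ` S \<Longrightarrow> m \<le> x"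
      using wfp_on_lessE[OF B] by blast
    then obtain a where "a \<in> S" "\<And>x. x \<in> S \<Longrightarrow> s - a \<le> s - x" by blast
    then show "\<exists>m\<in>S. \<forall>x\<in>S. x \<le> m" by (intro bexI[of _ a]) auto
  qed
  moreover have "{(a, b). a \<in> A \<and> b \<in> B \<and> a + b = s} = (\<lambda>a. (a, s - a)) ` ?X"
    by (force simp: algebra_simps)
  ultimately show ?thesis by simp
qed


section \<open>Hahn series\<close>

typedef (overloaded) ('k::zero, 'g::linorder) hahn =
  "{f :: 'g \<Rightarrow> 'k. wfp_on {g. f g \<noteq> 0} (<)}"
  morphisms hcoeff Abs_hahn
  by (rule exI[of _ "\<lambda>_. 0"]) (simp add: wfp_on_def)

setup_lifting type_definition_hahn

definition hsupp :: "('k::zero, 'g::linorder) hahn \<Rightarrow> 'g set" where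
  "hsupp f = {g. hcoeff f g \<noteq> 0}"

lemma wfp_on_hsupp: "wfp_on (hsupp f) (<)"
  using hcoeff[of f] by (simp add: hsupp_def)

lemma hahn_eqI: "(\<And>g. hcoeff f g = hcoeff h g) \<Longrightarrow> f = h"
  by (simp add: hcoeff_inject[symmetric] fun_eq_iff)

lemma hcoeff_Abs_hahn:
  "wfp_on A (<) \<Longrightarrow> {g. f g \<noteq> 0} \<subseteq> A \<Longrightarrow> hcoeff (Abs_hahn f) = f"
  by (rule Abs_hahn_inverse) (auto intro: wfp_on_subset)

text \<open>The monomial \<open>a t\<^sup>g\<close>.\<close>

lift_definition hmonom :: "'k::zero \<Rightarrow> 'g::linorder \<Rightarrow> ('k, 'g) hahn" is
  "\<lambda>a g h. if h = g then a else 0"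
  subgoal for a g
    by (rule wfp_on_subset[of "{g}"]) (auto simp: wfp_on_def split: if_splits)
  done

text \<open>The product is the Cauchy product; the index set of the sum is finite because the
  supports are well-ordered.\<close>

definition hmult_coeff ::
  "('k::semiring_0, 'g::linordered_ab_group_add) hahn \<Rightarrow> ('k, 'g) hahn \<Rightarrow> 'g \<Rightarrow> 'k" where
  "hmult_coeff f h s =
     (\<Sum>(a, b) \<in> {(a, b). a \<in> hsupp f \<and> b \<in> hsupp h \<and> a + b = s}. hcoeff f a * hcoeff h b)"

instantiation hahn :: (zero, linorder) zero
begin
lift_definition zero_hahn :: "('a, 'b) hahn" is "\<lambda>_. 0" by (simp add: wfp_on_def)
instance ..
end

instantiation hahn :: (ring_1, linordered_ab_group_add) "{one, plus, uminus, minus, times}"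
begin

definition one_hahn :: "('a, 'b) hahn" where "1 = hmonom 1 0"

lift_definition plus_hahn :: "('a, 'b) hahn \<Rightarrow> ('a, 'b) hahn \<Rightarrow> ('a, 'b) hahn" is
  "\<lambda>f h g. f g + h g"
  subgoal for f h
    by (rule wfp_on_subset[OF wfp_on_less_Un[of "{g. f g \<noteq> 0}" "{g. h g \<noteq> 0}"]]) auto
  done

lift_definition uminus_hahn :: "('a, 'b) hahn \<Rightarrow> ('a, 'b) hahn" is "\<lambda>f g. - f g"
  by simp

lift_definition minus_hahn :: "('a, 'b) hahn \<Rightarrow> ('a, 'b) hahn \<Rightarrow> ('a, 'b) hahn" is
  "\<lambda>f h g. f g - h g"
  subgoal for f h
    by (rule wfp_on_subset[OF wfp_on_less_Un[of "{g. f g \<noteq> 0}" "{g. h g \<noteq> 0}"]]) auto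
  done

definition times_hahn :: "('a, 'b) hahn \<Rightarrow> ('a, 'b) hahn \<Rightarrow> ('a, 'b) hahn" where
  "f * h = Abs_hahn (hmult_coeff f h)"

instance ..

end

lemma hcoeff_zero [simp]: "hcoeff 0 g = 0" by transfer simp

lemma hcoeff_add [simp]: "hcoeff (f + h) g = hcoeff f g + hcoeff h g" by transfer simp

lemma hcoeff_uminus [simp]: "hcoeff (- f) g = - hcoeff f g" by transfer simp

lemma hcoeff_diff [simp]: "hcoeff (f - h) g = hcoeff f g - hcoeff h g" by transfer simp

lemma hcoeff_hmonom: "hcoeff (hmonom a g) h = (if h = g then a else 0)" by transfer simp

lemma hcoeff_mult: "hcoeff (f * h) = hmult_coeff f h"
  unfolding times_hahn_def
proof (rule hcoeff_Abs_hahn[OF wfp_on_less_sums[OF wfp_on_hsupp wfp_on_hsupp]])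
  show "{g. hmult_coeff f h g \<noteq> 0} \<subseteq> {a + b |a b. a \<in> hsupp f \<and> b \<in> hsupp h}"
    unfolding hmult_coeff_def using sum.not_neutral_contains_not_neutral by fastforce
qed

lemma hcoeff_mult_superset:
  assumes A: "wfp_on A (<)" "hsupp f \<subseteq> A" and B: "wfp_on B (<)" "hsupp h \<subseteq> B"
  shows "hcoeff (f * h) s =
    (\<Sum>(a, b) \<in> {(a, b). a \<in> A \<and> b \<in> B \<and> a + b = s}. hcoeff f a * hcoeff h b)"
  unfolding hcoeff_mult hmult_coeff_def
  by (rule sum.mono_neutral_left[OF finite_sum_decompositions[OF A(1) B(1)]])
     (use A(2) B(2) in \<open>auto simp: hsupp_def\<close>)

lemma hsupp_mult: "hsupp (f * h) \<subseteq> {a + b |a b. a \<in> hsupp f \<and> b \<in> hsupp h}"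
  unfolding hsupp_def[of "f * h"] hcoeff_mult hmult_coeff_def
  using sum.not_neutral_contains_not_neutral by fastforce

lemma hahn_mult_assoc:
  fixes f h k :: "('k::ring_1, 'g::linordered_ab_group_add) hahn"
  shows "f * h * k = f * (h * k)"
proof (rule hahn_eqI)
  fix s
  let ?A = "hsupp f" and ?B = "hsupp h" and ?C = "hsupp k"
  let ?AB = "{a + b |a b. a \<in> ?A \<and> b \<in> ?B}" and ?BC = "{a + b |a b. a \<in> ?B \<and> b \<in> ?C}"
  note wo = wfp_on_hsupp[of f] wfp_on_hsupp[of h] wfp_on_hsupp[of k]
  note AB = wfp_on_less_sums[OF wo(1,2)] and BC = wfp_on_less_sums[OF wo(2,3)]
  let ?D = "\<lambda>A B (s::'g). {(a, b). a \<in> A \<and> b \<in> B \<and> a + b = s}"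
  have "hcoeff (f * h * k) s =
      (\<Sum>(d, c) \<in> ?D ?AB ?C s. hcoeff (f * h) d * hcoeff k c)"
    by (rule hcoeff_mult_superset[OF AB hsupp_mult wo(3)]) simp
  also have "\<dots> = (\<Sum>x \<in> ?D ?AB ?C s. \<Sum>y \<in> ?D ?A ?B (fst x).
      hcoeff f (fst y) * hcoeff h (snd y) * hcoeff k (snd x))"
    by (rule sum.cong) (auto simp: hcoeff_mult hmult_coeff_def sum_distrib_right split_def)
  also have "\<dots> = (\<Sum>(x, y) \<in> Sigma (?D ?AB ?C s) (\<lambda>x. ?D ?A ?B (fst x)).
      hcoeff f (fst y) * hcoeff h (snd y) * hcoeff k (snd x))"
    using finite_sum_decompositions[OF AB wo(3)] finite_sum_decompositions[OF wo(1,2)]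
    by (subst sum.Sigma) auto
  also have "\<dots> = (\<Sum>(x, y) \<in> Sigma (?D ?A ?BC s) (\<lambda>x. ?D ?B ?C (snd x)).
      hcoeff f (fst x) * (hcoeff h (fst y) * hcoeff k (snd y)))"
    by (rule sum.reindex_bij_witness
        [of _ "\<lambda>((a, _), (b, c)). ((a + b, c), (a, b))"
              "\<lambda>((_, c), (a, b)). ((a, b + c), (b, c))"])
       (auto simp: mult.assoc add.assoc)
  also have "\<dots> = (\<Sum>x \<in> ?D ?A ?BC s. \<Sum>y \<in> ?D ?B ?C (snd x).
      hcoeff f (fst x) * (hcoeff h (fst y) * hcoeff k (snd y)))"
    using finite_sum_decompositions[OF wo(1) BC] finite_sum_decompositions[OF wo(2,3)]
    by (subst sum.Sigma) auto
  also have "\<dots> = (\<Sum>(a, d) \<in> ?D ?A ?BC s. hcoeff f a * hcoeff (h * k) d)"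
    by (rule sum.cong) (auto simp: hcoeff_mult hmult_coeff_def sum_distrib_left split_def)
  also have "\<dots> = hcoeff (f * (h * k)) s"
    by (rule hcoeff_mult_superset[OF wo(1) _ BC hsupp_mult, symmetric]) simp
  finally show "hcoeff (f * h * k) s = hcoeff (f * (h * k)) s" .
qed

lemma hahn_mult_commute:
  fixes f h :: "('k::comm_ring_1, 'g::linordered_ab_group_add) hahn"
  shows "f * h = h * f"
  by (rule hahn_eqI, unfold hcoeff_mult hmult_coeff_def,
      rule sum.reindex_bij_witness[of _ prod.swap prod.swap]) (auto simp: ac_simps)

lemma hahn_distrib_right:
  fixes f h k :: "('k::ring_1, 'g::linordered_ab_group_add) hahn"
  shows "(f + h) * k = f * k + h * k"
proof (rule hahn_eqI)
  fix s
  let ?A = "hsupp f \<union> hsupp h"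
  have A: "wfp_on ?A (<)" by (rule wfp_on_less_Un[OF wfp_on_hsupp wfp_on_hsupp])
  have sub: "hsupp (f + h) \<subseteq> ?A" "hsupp f \<subseteq> ?A" "hsupp h \<subseteq> ?A" by (auto simp: hsupp_def)
  show "hcoeff ((f + h) * k) s = hcoeff (f * k + h * k) s"
    unfolding hcoeff_add sub[THEN hcoeff_mult_superset[OF A _ wfp_on_hsupp order_refl]]
    by (simp add: split_def distrib_right sum.distrib)
qed

lemma hcoeff_hmonom_mult:
  fixes f :: "('k::ring_1, 'g::linordered_ab_group_add) hahn"
  shows "hcoeff (hmonom a g * f) s = a * hcoeff f (s - g)"
proof -
  have "hcoeff (hmonom a g * f) s =
      (\<Sum>(x, b) \<in> {(x, b). x \<in> {g} \<and> b \<in> insert (s - g) (hsupp f) \<and> x + b = s}.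
         hcoeff (hmonom a g) x * hcoeff f b)"
  proof (rule hcoeff_mult_superset)
    show "wfp_on {g} (<)" by (simp add: wfp_on_less_iff subset_singleton_iff)
    have "wfp_on {s - g} (<)" by (simp add: wfp_on_less_iff subset_singleton_iff)
    then show "wfp_on (insert (s - g) (hsupp f)) (<)"
      using wfp_on_less_Un[OF _ wfp_on_hsupp[of f]] by fastforce
  qed (auto simp: hsupp_def hcoeff_hmonom split: if_splits)
  also have "{(x, b). x \<in> {g} \<and> b \<in> insert (s - g) (hsupp f) \<and> x + b = s} = {(g, s - g)}"
    by (rule set_eqI) (simp add: split_paired_all, metis add_diff_cancel_left' add_diff_eq)
  finally show ?thesis by (simp add: hcoeff_hmonom)
qed

instance hahn :: (comm_ring_1, linordered_ab_group_add) comm_ring_1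
proof
  fix f h k :: "('a, 'b) hahn"
  show "f * h * k = f * (h * k)" by (rule hahn_mult_assoc)
  show "f * h = h * f" by (rule hahn_mult_commute)
  show "(f + h) * k = f * k + h * k" by (rule hahn_distrib_right)
  show "1 * f = f" by (rule hahn_eqI) (simp add: one_hahn_def hcoeff_hmonom_mult)
  have "hcoeff (1::('a, 'b) hahn) 0 = 1" by (simp add: one_hahn_def hcoeff_hmonom)
  then show "(0::('a, 'b) hahn) \<noteq> 1" by (metis hcoeff_zero zero_neq_one)
qed (rule hahn_eqI; simp)+


section \<open>Inverting small perturbations of the identity\<close>

text \<open>If \<open>T\<close> is additive and strictly increases the order of vanishing,
  then \<open>I - T\<close> is bijective.\<close>

lemma hsupp_least:
  assumes "f \<noteq> 0"
  obtains d where "hcoeff f d \<noteq> 0" "\<And>x. x < d \<Longrightarrow> hcoeff f x = 0"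
proof -
  have "hsupp f \<noteq> {}" using assms by (auto simp: hsupp_def intro: hahn_eqI)
  then obtain d where "d \<in> hsupp f" "\<And>x. x \<in> hsupp f \<Longrightarrow> d \<le> x"
    using wfp_on_lessE[OF wfp_on_hsupp order_refl] by blast
  then show ?thesis using that[of d] by (force simp: hsupp_def)
qed

lemma contracting_bij:
  fixes T :: "('k::comm_ring_1, 'g::linordered_ab_group_add) hahn \<Rightarrow> ('k, 'g) hahn"
  assumes diff: "\<And>y z. T (y - z) = T y - T z"
    and contr: "\<And>y d e. (\<And>x. x < d \<Longrightarrow> hcoeff y x = 0) \<Longrightarrow> e \<le> d \<Longrightarrow> hcoeff (T y) e = 0"
  shows "bij (\<lambda>y. y - T y)"
proof -
  define L where "L y = y - T y" for y
  have Ldiff: "L (y - z) = L y - L z" for y z by (simp add: L_def diff)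
  have Lco: "hcoeff (L y) e = hcoeff y e" if "\<And>x. x < d \<Longrightarrow> hcoeff y x = 0" "e \<le> d" for y d e
    using contr[OF that] by (simp add: L_def)
  have agree: "hcoeff y e = hcoeff z e"
    if "\<And>x. x < d \<Longrightarrow> hcoeff (L y) x = hcoeff (L z) x" and e: "e < d" for y z d e
  proof (rule ccontr)
    let ?w = "y - z"
    assume "hcoeff y e \<noteq> hcoeff z e"
    then have e': "hcoeff ?w e \<noteq> 0" by simp
    then have "?w \<noteq> 0" by (metis hcoeff_zero)
    then obtain m where m: "hcoeff ?w m \<noteq> 0" "\<And>x. x < m \<Longrightarrow> hcoeff ?w x = 0"
      using hsupp_least by blast
    then have "m < d" using e e' by (meson le_less_trans not_less)
    then have "hcoeff (L ?w) m = 0" by (simp add: Ldiff that(1))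
    then show False using Lco[of m ?w m] m by simp
  qed
  have inj: "inj L"
  proof (rule injI, rule ccontr)
    fix y z assume eq: "L y = L z" and "y \<noteq> z"
    then have "y - z \<noteq> 0" by simp
    then obtain m where m: "hcoeff (y - z) m \<noteq> 0" "\<And>x. x < m \<Longrightarrow> hcoeff (y - z) x = 0"
      using hsupp_least by blast
    have "hcoeff (L (y - z)) m = hcoeff (y - z) m" by (rule Lco[of m]) (use m in auto)
    then show False using m by (simp add: Ldiff eq)
  qed
  have "\<exists>y. L y = f" for f
  proof (rule ccontr)
    assume none: "\<nexists>y. L y = f"
    define P where "P y d \<longleftrightarrow> (\<forall>x\<ge>d. hcoeff y x = 0) \<and> (\<forall>x<d. hcoeff (L y) x = hcoeff f x)"
      for y d
    define Yf where "Yf x = (if \<exists>y d. P y d \<and> x < d then hcoeff (SOME y. \<exists>d. P y d \<and> x < d) x else 0)"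
      for x
    have agreeP: "hcoeff y x = hcoeff z x" if "P y d" "P z e" "x < d" "x < e" for y z d e x
      by (rule agree[of "min d e"]) (use that in \<open>auto simp: P_def\<close>)
    have Yf: "Yf x = hcoeff y x" if "P y d" "x < d" for y d x
    proof -
      have "\<exists>d. P (SOME y. \<exists>d. P y d \<and> x < d) d \<and> x < d"
        by (rule someI_ex) (use that in blast)
      then obtain e where e: "P (SOME y. \<exists>d. P y d \<and> x < d) e" "x < e" by blast
      have "\<exists>y d. P y d \<and> x < d" using that by blast
      then have "Yf x = hcoeff (SOME y. \<exists>d. P y d \<and> x < d) x" unfolding Yf_def by (rule if_P)
      also have "\<dots> = hcoeff y x" by (rule agreeP[OF e(1) that(1) e(2) that(2)])
      finally show ?thesis .
    qed
    have Yf0: "Yf x = 0" if "\<And>y d. P y d \<Longrightarrow> d \<le> x" for x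
    proof -
      have "\<not> (\<exists>y d. P y d \<and> x < d)" using that by (auto simp: not_less)
      then show ?thesis unfolding Yf_def by (rule if_not_P)
    qed
    have "wfp_on {x. Yf x \<noteq> 0} (<)"
      unfolding wfp_on_less_iff
    proof (intro allI impI)
      fix S assume S: "S \<subseteq> {x. Yf x \<noteq> 0}" "S \<noteq> {}"
      then obtain s where s: "s \<in> S" "Yf s \<noteq> 0" by blast
      then obtain y d where yd: "P y d" "s < d" using Yf0 by (meson not_less)
      have "{x\<in>S. x < d} \<subseteq> hsupp y" using S Yf[OF yd(1)] by (auto simp: hsupp_def)
      moreover have "{x\<in>S. x < d} \<noteq> {}" using s yd by blast
      ultimately obtain m where m: "m \<in> {x\<in>S. x < d}" "\<And>x. x \<in> {x\<in>S. x < d} \<Longrightarrow> m \<le> x"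
        using wfp_on_lessE[OF wfp_on_hsupp] by blast
      then show "\<exists>m\<in>S. \<forall>x\<in>S. m \<le> x" by (intro bexI[of _ m]) force+
    qed
    then have Y: "hcoeff (Abs_hahn Yf) = Yf" by (intro hcoeff_Abs_hahn) auto
    define Y where "Y = Abs_hahn Yf"
    have LY: "hcoeff (L Y) x = hcoeff f x" if "P y d" "x < d" for y d x
    proof -
      have "hcoeff (L (Y - y)) x = hcoeff (Y - y) x"
        by (rule Lco[of d]) (use that Yf in \<open>auto simp: Y_def Y\<close>)
      then show ?thesis using that Yf[OF that] by (auto simp: Ldiff Y Y_def P_def)
    qed
    have "L Y - f \<noteq> 0" using none by auto
    then obtain d where d: "hcoeff (L Y - f) d \<noteq> 0" "\<And>x. x < d \<Longrightarrow> hcoeff (L Y - f) x = 0"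
      using hsupp_least by blast
    have Gd: "e \<le> d" if "P y e" for y e
      using LY[OF that, of d] d(1) by force
    let ?r = "hmonom (hcoeff (L Y - f) d) d"
    define Z where "Z = Y - ?r"
    have LZ: "hcoeff (L Z - f) x = 0" if "x \<le> d" for x
    proof -
      have "hcoeff (L ?r) x = hcoeff ?r x"
        by (rule Lco[OF _ that]) (auto simp: hcoeff_hmonom)
      then show ?thesis using d(2)[of x] that
        by (cases "x = d") (auto simp: Z_def Ldiff hcoeff_hmonom)
    qed
    have "L Z - f \<noteq> 0" using none by auto
    then obtain e where e: "hcoeff (L Z - f) e \<noteq> 0" "\<And>x. x < e \<Longrightarrow> hcoeff (L Z - f) x = 0"
      using hsupp_least by blast
    have "d < e" using e(1) LZ by (meson not_less)
    moreover have "P Z e"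
      unfolding P_def
    proof (intro conjI allI impI)
      fix x assume "e \<le> x"
      then have x: "d < x" using \<open>d < e\<close> by simp
      then have "Yf x = 0" using Gd Yf0 by (meson less_imp_le order_trans)
      then show "hcoeff Z x = 0" using x by (auto simp: Z_def Y_def Y hcoeff_hmonom)
    qed (use e(2) in auto)
    ultimately show False using Gd by force
  qed
  then have "surj L" by (metis surjI)
  with inj show ?thesis unfolding L_def[abs_def] by (simp add: bij_def)
qed

text \<open>\<open>f \<prec> 1\<close>\<close>

definition hsmall :: "('k::zero, 'g::linordered_ab_group_add) hahn \<Rightarrow> bool" where
  "hsmall f \<longleftrightarrow> hsupp f \<subseteq> {0<..}"

lemma hsmall_mult_contracting:
  fixes a :: "('k::comm_ring_1, 'g::linordered_ab_group_add) hahn"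
  assumes "hsmall a" "\<And>x. x < d \<Longrightarrow> hcoeff y x = 0" "e \<le> d"
  shows "hcoeff (a * y) e = 0"
proof (rule ccontr)
  assume "hcoeff (a * y) e \<noteq> 0"
  then obtain u v where uv: "u \<in> hsupp a" "v \<in> hsupp y" "e = u + v"
    using hsupp_mult[of a y] by (auto simp: hsupp_def)
  then have "0 < u" "d \<le> v" using assms(1,2) by (auto simp: hsmall_def hsupp_def not_less[symmetric])
  then have "d < u + v" by (metis add_0 add_less_le_mono)
  then show False using uv assms(3) by simp
qed

lemma hahn_ex_inverse:
  fixes f :: "('k::field, 'g::linordered_ab_group_add) hahn"
  assumes "f \<noteq> 0"
  shows "\<exists>y. y * f = 1"
proof -
  obtain d where d: "hcoeff f d \<noteq> 0" "\<And>x. x < d \<Longrightarrow> hcoeff f x = 0"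
    using hsupp_least[OF assms] by blast
  define m where "m = (hmonom (inverse (hcoeff f d)) (- d) :: ('k, 'g) hahn)"
  define a where "a = 1 - m * f"
  have "hsmall a"
    unfolding hsmall_def
  proof
    fix x assume "x \<in> hsupp a"
    then have x: "hcoeff a x \<noteq> 0" by (simp add: hsupp_def)
    have "hcoeff a x = (if x = 0 then 1 else 0) - inverse (hcoeff f d) * hcoeff f (x + d)"
      by (simp add: a_def m_def hcoeff_hmonom_mult one_hahn_def hcoeff_hmonom)
    moreover have "hcoeff f (x + d) = 0" if "x < 0" using d(2)[of "x + d"] that by simp
    ultimately have "\<not> x < 0" "x \<noteq> 0" using x d(1) by (auto split: if_splits)
    then show "x \<in> {0<..}" by auto
  qed
  then have "bij (\<lambda>y. y - a * y)"
    by (intro contracting_bij hsmall_mult_contracting) (auto simp: algebra_simps)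
  then obtain y where "y - a * y = 1" by (metis bij_pointE)
  then have "(y * m) * f = 1" by (simp add: a_def algebra_simps)
  then show ?thesis by blast
qed

instantiation hahn :: (field, linordered_ab_group_add) inverse
begin

definition inverse_hahn :: "('a, 'b) hahn \<Rightarrow> ('a, 'b) hahn" where
  "inverse_hahn f = (if f = 0 then 0 else SOME y. y * f = 1)"

definition divide_hahn :: "('a, 'b) hahn \<Rightarrow> ('a, 'b) hahn \<Rightarrow> ('a, 'b) hahn" where
  "divide_hahn f h = f * inverse h"

instance ..

end

instance hahn :: (field, linordered_ab_group_add) field
proof
  fix f h :: "('a, 'b) hahn"
  show "inverse f * f = 1" if "f \<noteq> 0"
    using someI_ex[OF hahn_ex_inverse[OF that]] that by (simp add: inverse_hahn_def)
qed (simp_all add: inverse_hahn_def divide_hahn_def)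


section \<open>Derivations and truncation\<close>

definition derivation :: "('k::comm_ring_1 \<Rightarrow> 'k) \<Rightarrow> bool" where
  "derivation \<delta> \<longleftrightarrow>
     (\<forall>x y. \<delta> (x + y) = \<delta> x + \<delta> y) \<and> (\<forall>x y. \<delta> (x * y) = \<delta> x * y + x * \<delta> y)"

text \<open>The support of the coefficient function is well-ordered as soon as \<open>\<delta> 0 = 0\<close>,
  see \<open>hcoeff_hderiv\<close>.\<close>

definition hderiv ::
  "('k::comm_ring_1 \<Rightarrow> 'k) \<Rightarrow> ('g::linordered_ab_group_add \<Rightarrow> 'k) \<Rightarrow> ('k, 'g) hahn \<Rightarrow> ('k, 'g) hahn"
where
  "hderiv \<delta> c f = Abs_hahn (\<lambda>g. \<delta> (hcoeff f g) + hcoeff f g * c g)"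

lift_definition htrunc :: "('k::zero, 'g::linorder) hahn \<Rightarrow> 'g \<Rightarrow> ('k, 'g) hahn" is
  "\<lambda>f g0 g. if g < g0 then f g else 0"
  by (rule wfp_on_subset) auto

definition trunc_closed :: "('k::zero, 'g::linorder) hahn set \<Rightarrow> bool" where
  "trunc_closed F \<longleftrightarrow> (\<forall>f\<in>F. \<forall>g. htrunc f g \<in> F)"

definition is_subfield :: "'a::field set \<Rightarrow> bool" where
  "is_subfield F \<longleftrightarrow> 0 \<in> F \<and> 1 \<in> F \<and>
     (\<forall>x\<in>F. \<forall>y\<in>F. x + y \<in> F \<and> x * y \<in> F) \<and> (\<forall>x\<in>F. - x \<in> F \<and> inverse x \<in> F)"

definition is_diff_subfield :: "('a::field \<Rightarrow> 'a) \<Rightarrow> 'a set \<Rightarrow> bool" where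
  "is_diff_subfield D F \<longleftrightarrow> is_subfield F \<and> (\<forall>x\<in>F. D x \<in> F)"

text \<open>The operator \<open>I - a\<partial>\<close>.\<close>

definition id_minus :: "('a::ring \<Rightarrow> 'a) \<Rightarrow> 'a \<Rightarrow> 'a \<Rightarrow> 'a" where
  "id_minus D a y = y - a * D y"

text \<open>For \<open>D = hderiv \<delta> c\<close> the operator is bijective by \<open>bij_id_minus_hderiv\<close>,
  so that \<open>inv\<close> is its two-sided inverse.\<close>

definition resolvent_closed ::
  "(('k::field, 'g::linordered_ab_group_add) hahn \<Rightarrow> ('k, 'g) hahn) \<Rightarrow> ('k, 'g) hahn set \<Rightarrow> bool"
where
  "resolvent_closed D F \<longleftrightarrow> (\<forall>a\<in>F. hsmall a \<longrightarrow> (\<forall>f\<in>F. inv (id_minus D a) f \<in> F))"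

text \<open>That this intersection is the smallest member of the family is
  \<open>resolvent_hull_least\<close>.\<close>

definition resolvent_hull ::
  "(('k::field, 'g::linordered_ab_group_add) hahn \<Rightarrow> ('k, 'g) hahn) \<Rightarrow>
   ('k, 'g) hahn set \<Rightarrow> ('k, 'g) hahn set"
where
  "resolvent_hull D E = \<Inter> {F. is_diff_subfield D F \<and> resolvent_closed D F \<and> E \<subseteq> F}"

lemma resolvent_hull_least:
  "is_diff_subfield D (resolvent_hull D E)"
  "resolvent_closed D (resolvent_hull D E)"
  "E \<subseteq> resolvent_hull D E"
  "is_diff_subfield D F \<Longrightarrow> resolvent_closed D F \<Longrightarrow> E \<subseteq> F \<Longrightarrow> resolvent_hull D E \<subseteq> F"
proof -
  let ?\<F> = "{F. is_diff_subfield D F \<and> resolvent_closed D F \<and> E \<subseteq> F}"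
  show "is_diff_subfield D (resolvent_hull D E)"
    unfolding is_diff_subfield_def is_subfield_def
  proof (intro conjI ballI)
    have "0 \<in> F \<and> 1 \<in> F" if "F \<in> ?\<F>" for F
      using that by (auto simp: is_diff_subfield_def is_subfield_def)
    then show "0 \<in> resolvent_hull D E" "1 \<in> resolvent_hull D E"
      by (simp_all add: resolvent_hull_def)
    fix x assume x: "x \<in> resolvent_hull D E"
    have "- x \<in> F \<and> inverse x \<in> F \<and> D x \<in> F" if "F \<in> ?\<F>" for F
      using that x by (auto simp: is_diff_subfield_def is_subfield_def resolvent_hull_def)
    then show "- x \<in> resolvent_hull D E" "inverse x \<in> resolvent_hull D E"
        "D x \<in> resolvent_hull D E"
      by (simp_all add: resolvent_hull_def)
    fix y assume y: "y \<in> resolvent_hull D E"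
    have "x + y \<in> F \<and> x * y \<in> F" if "F \<in> ?\<F>" for F
      using that x y by (auto simp: is_diff_subfield_def is_subfield_def resolvent_hull_def)
    then show "x + y \<in> resolvent_hull D E" "x * y \<in> resolvent_hull D E"
      by (simp_all add: resolvent_hull_def)
  qed
  show "resolvent_closed D (resolvent_hull D E)"
    unfolding resolvent_closed_def
  proof (intro ballI impI)
    fix a f assume a: "a \<in> resolvent_hull D E" "hsmall a" and f: "f \<in> resolvent_hull D E"
    have "inv (id_minus D a) f \<in> F" if "F \<in> ?\<F>" for F
      using that a f by (simp add: resolvent_hull_def resolvent_closed_def)
    then show "inv (id_minus D a) f \<in> resolvent_hull D E"
      by (simp add: resolvent_hull_def)
  qed
qed (auto simp: resolvent_hull_def)

lemma derivation_0: "derivation \<delta> \<Longrightarrow> \<delta> 0 = 0"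
  unfolding derivation_def by (metis add_0 add_cancel_right_right)

lemma hcoeff_hderiv:
  assumes "derivation \<delta>"
  shows "hcoeff (hderiv \<delta> c f) g = \<delta> (hcoeff f g) + hcoeff f g * c g"
  unfolding hderiv_def
  by (subst hcoeff_Abs_hahn[OF wfp_on_hsupp[of f]])
     (auto simp: hsupp_def derivation_0[OF assms])

lemma hcoeff_htrunc: "hcoeff (htrunc f g0) g = (if g < g0 then hcoeff f g else 0)"
  by transfer simp

lemma hderiv_derivation:
  assumes \<delta>: "derivation \<delta>" and c: "Modules.additive c"
  shows "derivation (hderiv \<delta> c)"
proof -
  note add = \<delta>[unfolded derivation_def, THEN conjunct1, rule_format]
  note mult = \<delta>[unfolded derivation_def, THEN conjunct2, rule_format]
  have \<delta>sum: "\<delta> (sum h A) = (\<Sum>x\<in>A. \<delta> (h x))" for h :: "'x \<Rightarrow> 'a" and A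
    by (induction A rule: infinite_finite_induct) (simp_all add: add derivation_0[OF \<delta>])
  have sub: "hsupp (hderiv \<delta> c f) \<subseteq> hsupp f" for f
    by (auto simp: hsupp_def hcoeff_hderiv[OF \<delta>] derivation_0[OF \<delta>])
  have "hderiv \<delta> c (f * h) = hderiv \<delta> c f * h + f * hderiv \<delta> c h" for f h
  proof (rule hahn_eqI)
    fix s
    let ?D = "{(a, b). a \<in> hsupp f \<and> b \<in> hsupp h \<and> a + b = s}"
    have "hcoeff (hderiv \<delta> c f * h + f * hderiv \<delta> c h) s =
        (\<Sum>(a, b)\<in>?D. hcoeff (hderiv \<delta> c f) a * hcoeff h b + hcoeff f a * hcoeff (hderiv \<delta> c h) b)"
      unfolding hcoeff_add
        hcoeff_mult_superset[OF wfp_on_hsupp sub wfp_on_hsupp order_refl]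
        hcoeff_mult_superset[OF wfp_on_hsupp order_refl wfp_on_hsupp sub]
      by (simp add: split_def sum.distrib)
    also have "\<dots> = (\<Sum>(a, b)\<in>?D. \<delta> (hcoeff f a * hcoeff h b) + hcoeff f a * hcoeff h b * c s)"
      by (rule sum.cong)
         (auto simp: hcoeff_hderiv[OF \<delta>] mult additive.add[OF c] algebra_simps)
    also have "\<dots> = hcoeff (hderiv \<delta> c (f * h)) s"
      by (simp add: hcoeff_hderiv[OF \<delta>] hcoeff_mult hmult_coeff_def \<delta>sum split_def
          sum.distrib sum_distrib_right)
    finally show "hcoeff (hderiv \<delta> c (f * h)) s =
        hcoeff (hderiv \<delta> c f * h + f * hderiv \<delta> c h) s" by simp
  qed
  then show ?thesis
    unfolding derivation_def
    by (auto intro!: hahn_eqI simp: hcoeff_hderiv[OF \<delta>] add algebra_simps)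
qed

lemma bij_id_minus_hderiv:
  assumes \<delta>: "derivation \<delta>" and a: "hsmall a"
  shows "bij (id_minus (hderiv \<delta> c) a)"
proof -
  note add = \<delta>[unfolded derivation_def, THEN conjunct1, rule_format]
  have \<delta>diff: "\<delta> (x - y) = \<delta> x - \<delta> y" for x y using add[of "x - y" y] by simp
  have diff: "hderiv \<delta> c (y - z) = hderiv \<delta> c y - hderiv \<delta> c z" for y z
    by (rule hahn_eqI) (simp add: hcoeff_hderiv[OF \<delta>] \<delta>diff algebra_simps)
  have "bij (\<lambda>y. y - a * hderiv \<delta> c y)"
  proof (rule contracting_bij)
    show "a * hderiv \<delta> c (y - z) = a * hderiv \<delta> c y - a * hderiv \<delta> c z" for y z
      by (simp add: diff algebra_simps)
    show "hcoeff (a * hderiv \<delta> c y) e = 0"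
      if "\<And>x. x < d \<Longrightarrow> hcoeff y x = 0" "e \<le> d" for y d e
      by (rule hsmall_mult_contracting[OF a _ that(2)])
         (simp add: hcoeff_hderiv[OF \<delta>] that(1) derivation_0[OF \<delta>])
  qed
  then show ?thesis unfolding id_minus_def[abs_def] .
qed

end

theory Submission
  imports Defs
begin

text \<open>
  Let \<open>H\<close> be the hull and \<open>C\<close> the set of those elements of \<open>H\<close> all of whose truncations lie in
  \<open>H\<close>. By minimality of \<open>H\<close> it suffices that \<open>C\<close> is a resolvent closed differential subfield.

  As \<open>\<alpha>\<close> increases in the support of \<open>f\<close>, the truncations \<open>h|(\<gamma> - \<alpha>)\<close> decrease, so only finitely
  many distinct ones occur, and \<open>(fh)|\<gamma>\<close> is a finite sum of products of truncation differences
  of \<open>f\<close> with truncations of \<open>h\<close>. Hence \<open>C\<close> is a ring.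
  If \<open>y = f + a y'\<close> with \<open>a \<prec> 1\<close>, the same decomposition of \<open>(a y')|\<gamma>\<close> yields
  \<open>y|\<gamma> - b (y|\<gamma>)' \<in> H\<close>, where \<open>b\<close> is \<open>a\<close> or a truncation of \<open>a\<close>, provided that all proper truncations
  of \<open>y|\<gamma>\<close> lie in \<open>H\<close>; so \<open>y|\<gamma> \<in> H\<close> by induction along the support of \<open>y\<close>.
  Inverses are treated in the same way, with the identity in place of the derivation.
\<close>

section \<open>Truncation of sums and products\<close>

lemma htrunc_add: "htrunc (f + h) g = htrunc f g + htrunc h g"
  by (rule hahn_eqI) (simp add: hcoeff_htrunc)

lemma htrunc_uminus: "htrunc (- f) g = - htrunc f g"
  by (rule hahn_eqI) (simp add: hcoeff_htrunc)

lemma htrunc_htrunc: "htrunc (htrunc f g) g' = htrunc f (min g g')"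
  by (rule hahn_eqI) (auto simp: hcoeff_htrunc)

lemma hsupp_htrunc: "hsupp (htrunc f g) = {x \<in> hsupp f. x < g}"
  by (auto simp: hsupp_def hcoeff_htrunc)

lemma hsupp_diff_htrunc:
  fixes f :: "('k::ring_1, 'g::linordered_ab_group_add) hahn"
  shows "hsupp (f - htrunc f g) = {x \<in> hsupp f. g \<le> x}"
  by (auto simp: hsupp_def hcoeff_htrunc)

lemma hsupp_htrunc_diff_htrunc:
  fixes f :: "('k::ring_1, 'g::linordered_ab_group_add) hahn"
  assumes "g \<le> g'"
  shows "hsupp (htrunc f g' - htrunc f g) = {x \<in> hsupp f. g \<le> x \<and> x < g'}"
  using assms by (auto simp: hsupp_def hcoeff_htrunc split: if_splits)

lemma htrunc_eq_self: "(\<And>x. x \<in> hsupp f \<Longrightarrow> x < g) \<Longrightarrow> htrunc f g = f"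
  by (rule hahn_eqI) (auto simp: hcoeff_htrunc hsupp_def)

lemma htrunc_eq_0: "(\<And>x. x \<in> hsupp f \<Longrightarrow> g \<le> x) \<Longrightarrow> htrunc f g = 0"
  by (rule hahn_eqI) (force simp: hcoeff_htrunc hsupp_def)

lemma hsmall_htrunc: "hsmall f \<Longrightarrow> hsmall (htrunc f g)"
  by (auto simp: hsmall_def hsupp_htrunc)

text \<open>Exponents of \<open>h\<close> from \<open>d\<close> on only yield exponents at or above
  \<open>g\<close> in the product.\<close>

lemma htrunc_mult_htrunc_right:
  fixes f h :: "('k::comm_ring_1, 'g::linordered_ab_group_add) hahn"
  assumes "\<And>x y. x \<in> hsupp f \<Longrightarrow> y \<in> hsupp h \<Longrightarrow> d \<le> y \<Longrightarrow> g \<le> x + y"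
  shows "htrunc (f * h) g = htrunc (f * htrunc h d) g"
proof -
  have "f * h = f * htrunc h d + f * (h - htrunc h d)" by (simp add: algebra_simps)
  moreover have "htrunc (f * (h - htrunc h d)) g = 0"
    by (rule htrunc_eq_0)
       (use hsupp_mult[of f "h - htrunc h d"] assms in \<open>auto simp: hsupp_diff_htrunc\<close>)
  ultimately show ?thesis by (simp add: htrunc_add)
qed

text \<open>For every exponent \<open>x\<close> of \<open>f\<close> the cuts \<open>g - x\<close>
  and \<open>d\<close> select the same part of \<open>h\<close>, so a single truncation of
  \<open>h\<close> serves all of \<open>f\<close>.\<close>

lemma htrunc_mult_eq:
  fixes f h :: "('k::comm_ring_1, 'g::linordered_ab_group_add) hahn"
  assumes "\<And>x y. x \<in> hsupp f \<Longrightarrow> y \<in> hsupp h \<Longrightarrow> x + y < g \<longleftrightarrow> y < d"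
  shows "htrunc (f * h) g = f * htrunc h d"
proof -
  have "htrunc (f * h) g = htrunc (f * htrunc h d) g"
    by (rule htrunc_mult_htrunc_right) (use assms in \<open>meson not_less\<close>)
  also have "\<dots> = f * htrunc h d"
    by (rule htrunc_eq_self)
       (use hsupp_mult[of f "htrunc h d"] assms in \<open>auto simp: hsupp_htrunc\<close>)
  finally show ?thesis .
qed


section \<open>Elements with all truncations in a subfield\<close>

text \<open>The largest truncation closed subset of \<open>H\<close>.\<close>

definition trunc_core :: "('k::zero, 'g::linorder) hahn set \<Rightarrow> ('k, 'g) hahn set" where
  "trunc_core H = {f \<in> H. \<forall>g. htrunc f g \<in> H}"

lemma trunc_core_subset: "trunc_core H \<subseteq> H"
  by (auto simp: trunc_core_def)

lemma htrunc_trunc_core: "f \<in> trunc_core H \<Longrightarrow> htrunc f g \<in> trunc_core H"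
  by (auto simp: trunc_core_def htrunc_htrunc)

text \<open>A monomial has no truncations besides itself and \<open>0\<close>.\<close>

lemma hmonom_in_trunc_core:
  assumes "hmonom a d \<in> H" "0 \<in> H"
  shows "hmonom a d \<in> trunc_core H"
proof -
  have "htrunc (hmonom a d) g = (if d < g then hmonom a d else 0)" for g
    by (rule hahn_eqI) (auto simp: hcoeff_htrunc hcoeff_hmonom)
  then show ?thesis using assms by (simp add: trunc_core_def)
qed

section \<open>Ring operations on the core\<close>

lemma is_subfield_minus: "is_subfield H \<Longrightarrow> x \<in> H \<Longrightarrow> y \<in> H \<Longrightarrow> x - y \<in> H"
  unfolding is_subfield_def by (metis add_uminus_conv_diff)

lemma trunc_core_add:
  assumes "is_subfield H" "f \<in> trunc_core H" "h \<in> trunc_core H"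
  shows "f + h \<in> trunc_core H"
  using assms by (auto simp: trunc_core_def htrunc_add is_subfield_def)

lemma trunc_core_uminus:
  assumes "is_subfield H" "f \<in> trunc_core H"
  shows "- f \<in> trunc_core H"
  using assms by (auto simp: trunc_core_def htrunc_uminus is_subfield_def)

lemma trunc_core_minus:
  assumes "is_subfield H" "f \<in> trunc_core H" "h \<in> trunc_core H"
  shows "f - h \<in> trunc_core H"
  using trunc_core_add[OF assms(1,2) trunc_core_uminus[OF assms(1,3)]] by simp

text \<open>The finite decomposition is not written down: initial blocks of \<open>f\<close> are
  split off one at a time, and well-ordering of the support of \<open>h\<close> ends the
  process.\<close>

lemma htrunc_mult_in_subfield:
  fixes f h :: "('k::field, 'g::linordered_ab_group_add) hahn"
  assumes H: "is_subfield H" and f: "f \<in> trunc_core H" and h: "h \<in> trunc_core H"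
  shows "htrunc (f * h) g \<in> H"
proof -
  note [simp] = H[unfolded is_subfield_def] is_subfield_minus[OF H]
  have fH: "f \<in> H" "\<And>g. htrunc f g \<in> H" and hH: "h \<in> H" "\<And>g. htrunc h g \<in> H"
    using f h by (auto simp: trunc_core_def)
  have step: "htrunc ((f - htrunc f d) * h) g \<in> H"
    if IH: "\<And>y d'. y \<in> hsupp h \<Longrightarrow> y < g - d \<Longrightarrow> g - d' \<le> y \<Longrightarrow> htrunc ((f - htrunc f d') * h) g \<in> H"
    for d
  proof -
    \<comment> \<open>\<open>S\<close> holds the exponents \<open>x \<ge> d\<close> of
      \<open>f\<close> whose cut \<open>g - x\<close> drops an exponent of \<open>h\<close> that the
      cut \<open>g - d\<close> keeps.\<close>
    define S where "S = {x \<in> hsupp f. d \<le> x \<and> (\<exists>y\<in>hsupp h. g - x \<le> y \<and> y < g - d)}"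
    have iff: "x + y < g \<longleftrightarrow> y < g - d"
      if "x \<in> hsupp f" "y \<in> hsupp h" "d \<le> x" "x \<notin> S" for x y
    proof
      assume "x + y < g"
      then have "y < g - x" by (simp add: less_diff_eq add.commute)
      then show "y < g - d" using that(3) by (meson diff_left_mono less_le_trans)
    next
      assume "y < g - d"
      then have "y < g - x" using that by (auto simp: S_def)
      then show "x + y < g" by (simp add: less_diff_eq add.commute)
    qed
    show ?thesis
    proof (cases "S = {}")
      case True
      then have "htrunc ((f - htrunc f d) * h) g = (f - htrunc f d) * htrunc h (g - d)"
        by (intro htrunc_mult_eq iff) (auto simp: hsupp_diff_htrunc)
      then show ?thesis by (simp add: fH hH)
    next
      case False
      have "S \<subseteq> hsupp f" by (auto simp: S_def)
      then obtain d' where d': "d' \<in> S" "\<And>x. x \<in> S \<Longrightarrow> d' \<le> x"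
        using wfp_on_lessE[OF wfp_on_hsupp _ False] by blast
      then obtain y where y: "y \<in> hsupp h" "g - d' \<le> y" "y < g - d" and dd': "d \<le> d'"
        by (auto simp: S_def)
      \<comment> \<open>The block of \<open>f\<close> from \<open>d\<close> up to the least element
        \<open>d'\<close> of \<open>S\<close> avoids \<open>S\<close>, so it needs only one
        truncation of \<open>h\<close>; the tail from \<open>d'\<close> is left to
        \<open>IH\<close>.\<close>
      have "htrunc ((htrunc f d' - htrunc f d) * h) g = (htrunc f d' - htrunc f d) * htrunc h (g - d)"
        by (intro htrunc_mult_eq iff)
           (use d'(2) in \<open>force simp: hsupp_htrunc_diff_htrunc[OF dd']\<close>)+
      moreover have "(f - htrunc f d) * h = (htrunc f d' - htrunc f d) * h + (f - htrunc f d') * h"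
        by (simp add: algebra_simps)
      ultimately show ?thesis using IH[OF y(1,3,2)] by (simp add: htrunc_add fH hH)
    qed
  qed
  \<comment> \<open>Passing from \<open>d\<close> to \<open>d'\<close> lowers the cut past an
    exponent of \<open>h\<close>, which drives an induction on an exponent \<open>y\<close> bounding
    the cut.\<close>
  have IH: "\<forall>d. g - d \<le> y \<longrightarrow> htrunc ((f - htrunc f d) * h) g \<in> H" if "y \<in> hsupp h" for y
    using wfp_on_hsupp[of h] that
  proof (induction y rule: wfp_on_induct)
    case in_set
    show ?case using that .
  next
    case (less y)
    show ?case
    proof (intro allI impI, rule step)
      fix d y' d' assume d: "g - d \<le> y" and y': "y' \<in> hsupp h" "y' < g - d" "g - d' \<le> y'"
      have "y' < y" using y'(2) d by (rule less_le_trans)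
      then show "htrunc ((f - htrunc f d') * h) g \<in> H" using less y'(1,3) by blast
    qed
  qed
  \<comment> \<open>With \<open>d\<close> a lower bound of the support (arbitrary if
    \<open>f = 0\<close>), the tail from \<open>d\<close> is all of \<open>f\<close>.\<close>
  obtain d where "\<And>x. x \<in> hsupp f \<Longrightarrow> d \<le> x"
    using wfp_on_lessE[OF wfp_on_hsupp order_refl] by (metis empty_iff)
  then have "htrunc f d = 0" by (rule htrunc_eq_0)
  moreover have "htrunc ((f - htrunc f d) * h) g \<in> H" by (rule step) (use IH in blast)
  ultimately show ?thesis by simp
qed

lemma trunc_core_mult:
  assumes "is_subfield H" "f \<in> trunc_core H" "h \<in> trunc_core H"
  shows "f * h \<in> trunc_core H"
  using assms htrunc_mult_in_subfield[OF assms] trunc_core_subset[of H]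
  by (auto simp: trunc_core_def is_subfield_def)

section \<open>Solutions of \<open>y - a * D y = f\<close>\<close>

text \<open>\<open>D\<close> is abstract in order to cover both the derivation and, for inverses,
  the identity. The hypothesis \<open>solve\<close> recovers \<open>z\<close> from
  \<open>z - b * D z\<close> within \<open>H\<close>.\<close>

lemma trunc_core_solution:
  fixes D :: "('k::field, 'g::linordered_ab_group_add) hahn \<Rightarrow> ('k, 'g) hahn"
  assumes H: "is_subfield H"
    and D_H: "\<And>z. z \<in> H \<Longrightarrow> D z \<in> H"
    and D_htrunc: "\<And>z g. htrunc (D z) g = D (htrunc z g)"
    and D_hsupp: "\<And>z. hsupp (D z) \<subseteq> hsupp z"
    and solve: "\<And>b z. b \<in> H \<Longrightarrow> hsmall b \<Longrightarrow> z - b * D z \<in> H \<Longrightarrow> z \<in> H"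
    and a: "a \<in> trunc_core H" "hsmall a" and f: "f \<in> trunc_core H"
    and y: "y - a * D y = f"
  shows "y \<in> trunc_core H"
proof -
  note [simp] = H[unfolded is_subfield_def] is_subfield_minus[OF H]
  have aH: "a \<in> H" "\<And>g. htrunc a g \<in> H" and fH: "f \<in> H" "\<And>g. htrunc f g \<in> H"
    using a f by (auto simp: trunc_core_def)
  have y': "y = f + a * D y" using y by (simp add: algebra_simps)
  \<comment> \<open>\<open>IH\<close> covers the truncations of \<open>y\<close> that lose some
    exponent \<open>x < g\<close>, that is, the proper truncations of
    \<open>htrunc y g\<close>.\<close>
  have step: "htrunc y g \<in> H"
    if IH: "\<And>x d. x \<in> hsupp y \<Longrightarrow> x < g \<Longrightarrow> d \<le> x \<Longrightarrow> htrunc y d \<in> H" for g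
  proof -
    \<comment> \<open>For an exponent \<open>u\<close> of \<open>a\<close> outside \<open>S\<close>,
      cutting \<open>y\<close> at \<open>g - u\<close> or at \<open>g\<close> is the same; for
      \<open>u\<close> in \<open>S\<close> the cut at \<open>g - u\<close> is a proper truncation of
      \<open>htrunc y g\<close>.\<close>
    define S where "S = {u \<in> hsupp a. \<exists>x\<in>hsupp y. g - u \<le> x \<and> x < g}"
    have pos: "0 < u" if "u \<in> hsupp a" for u using that a(2) by (auto simp: hsmall_def)
    have iff: "u + x < g \<longleftrightarrow> x < g" if "u \<in> hsupp a" "x \<in> hsupp (D y)" "u \<notin> S" for u x
    proof
      assume "u + x < g"
      then show "x < g" using pos[OF that(1)] by (metis add_0 add_less_cancel_right less_trans)
    next
      assume "x < g"
      then have "x < g - u" using that D_hsupp[of y] by (force simp: S_def)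
      then show "u + x < g" by (simp add: less_diff_eq add.commute)
    qed
    show ?thesis
    proof (cases "S = {}")
      case True
      then have "htrunc (a * D y) g = a * D (htrunc y g)"
        unfolding D_htrunc[symmetric] by (intro htrunc_mult_eq iff) auto
      \<comment> \<open>The truncated equation has the original form, now with right-hand side
        \<open>htrunc f g\<close>.\<close>
      then have "htrunc y g - a * D (htrunc y g) = htrunc f g"
        using arg_cong[OF y', of "\<lambda>z. htrunc z g"] by (simp add: htrunc_add)
      then have "htrunc y g - a * D (htrunc y g) \<in> H" by (simp add: fH)
      then show ?thesis by (rule solve[OF aH(1) a(2)])
    next
      case False
      have "S \<subseteq> hsupp a" by (auto simp: S_def)
      \<comment> \<open>\<open>S\<close> is a final segment of the support of \<open>a\<close>.
        Below \<open>d\<close>, \<open>a\<close> supplies the new coefficient \<open>b\<close>; from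
        \<open>d\<close> on it meets only \<open>D y\<close> below \<open>g - d\<close>, which
        \<open>IH\<close> controls.\<close>
      then obtain d where d: "d \<in> S" "\<And>u. u \<in> S \<Longrightarrow> d \<le> u"
        using wfp_on_lessE[OF wfp_on_hsupp _ False] by blast
      then obtain x where x: "x \<in> hsupp y" "x < g" "g - d \<le> x" by (auto simp: S_def)
      have "htrunc y d' \<in> H" if "d' \<le> g - d" for d'
        using IH[OF x(1,2)] x(3) that by (meson order_trans)
      then have "htrunc (D y) (g - d) \<in> trunc_core H"
        by (simp add: trunc_core_def htrunc_htrunc D_htrunc D_H)
      then have "htrunc ((a - htrunc a d) * htrunc (D y) (g - d)) g \<in> H"
        using htrunc_trunc_core[OF a(1)]
        by (intro htrunc_mult_in_subfield H trunc_core_minus a)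
      moreover have "htrunc ((a - htrunc a d) * D y) g =
          htrunc ((a - htrunc a d) * htrunc (D y) (g - d)) g"
      proof (rule htrunc_mult_htrunc_right)
        fix u v assume "u \<in> hsupp (a - htrunc a d)" "g - d \<le> v"
        then have "d + (g - d) \<le> u + v" by (intro add_mono) (auto simp: hsupp_diff_htrunc)
        then show "g \<le> u + v" by simp
      qed
      moreover have "htrunc (htrunc a d * D y) g = htrunc a d * D (htrunc y g)"
        unfolding D_htrunc[symmetric]
        by (intro htrunc_mult_eq iff) (use d(2) in \<open>force simp: hsupp_htrunc\<close>)+
      moreover have "y = f + (htrunc a d * D y + (a - htrunc a d) * D y)"
        using y' by (simp add: algebra_simps)
      then have "htrunc y g = htrunc f g + (htrunc (htrunc a d * D y) g +
          htrunc ((a - htrunc a d) * D y) g)"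
        by (metis htrunc_add)
      \<comment> \<open>The tail product moves to the right-hand side, leaving an equation with the
        small coefficient \<open>htrunc a d\<close>.\<close>
      ultimately have "htrunc y g - htrunc a d * D (htrunc y g) \<in> H"
        using fH by simp
      then show ?thesis by (rule solve[OF aH(2) hsmall_htrunc[OF a(2)]])
    qed
  qed
  have "\<forall>d. d \<le> x \<longrightarrow> htrunc y d \<in> H" if "x \<in> hsupp y" for x
    using wfp_on_hsupp[of y] that
  proof (induction x rule: wfp_on_induct)
    case in_set
    show ?case using that .
  next
    case (less x)
    show ?case
    proof (intro allI impI, rule step)
      fix g x' d assume g: "g \<le> x" and x': "x' \<in> hsupp y" "x' < g" "d \<le> x'"
      have "x' < x" using x'(2) g by (rule less_le_trans)
      then show "htrunc y d \<in> H" using less x'(1,3) by blast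
    qed
  qed
  \<comment> \<open>The induction reaches only cuts at or below an exponent of \<open>y\<close>; one
    more \<open>step\<close> gives arbitrary \<open>g\<close>.\<close>
  then have "htrunc y g \<in> H" for g by (intro step[of g]) blast
  moreover have "y \<in> H" by (rule solve[OF aH(1) a(2)]) (simp add: y fH)
  ultimately show ?thesis by (simp add: trunc_core_def)
qed

section \<open>Inverses\<close>

lemma hmonom_leading_in_trunc_core:
  fixes f :: "('k::field, 'g::linordered_ab_group_add) hahn"
  assumes "is_subfield H" "f \<in> trunc_core H" and d: "\<And>x. x < d \<Longrightarrow> hcoeff f x = 0"
  shows "hmonom (hcoeff f d) d \<in> trunc_core H"
proof (rule hmonom_in_trunc_core)
  show "0 \<in> H" using assms by (simp add: is_subfield_def)
  let ?S = "{x \<in> hsupp f. d < x}"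
  show "hmonom (hcoeff f d) d \<in> H"
  proof (cases "?S = {}")
    case True
    then have "hmonom (hcoeff f d) d = f"
      using d by (intro hahn_eqI) (force simp: hcoeff_hmonom hsupp_def neq_iff)
    then show ?thesis using assms trunc_core_subset by auto
  next
    case False
    \<comment> \<open>Truncating at the next exponent \<open>e\<close> after \<open>d\<close>
      isolates the monomial.\<close>
    then obtain e where e: "e \<in> ?S" "\<And>x. x \<in> ?S \<Longrightarrow> e \<le> x"
      using wfp_on_lessE[OF wfp_on_hsupp _ False] by blast
    have "hcoeff f x = 0" if "d < x" "x < e" for x
      using e(2)[of x] that by (force simp: hsupp_def)
    then have "hmonom (hcoeff f d) d = htrunc f e"
      using d e(1) by (intro hahn_eqI) (auto simp: hcoeff_hmonom hcoeff_htrunc neq_iff)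
    then show ?thesis using assms by (simp add: trunc_core_def)
  qed
qed

text \<open>Division by the leading monomial gives \<open>m * f = 1 - a\<close> with
  \<open>a\<close> small, whose inverse solves \<open>y - a * y = 1\<close>.\<close>

lemma trunc_core_inverse:
  fixes f :: "('k::field, 'g::linordered_ab_group_add) hahn"
  assumes H: "is_subfield H" and f: "f \<in> trunc_core H"
  shows "inverse f \<in> trunc_core H"
proof (cases "f = 0")
  case False
  obtain d where d: "hcoeff f d \<noteq> 0" "\<And>x. x < d \<Longrightarrow> hcoeff f x = 0"
    using hsupp_least[OF False] by blast
  have 1: "1 \<in> trunc_core H"
    using hmonom_in_trunc_core[of 1 0 H] H by (simp add: is_subfield_def one_hahn_def)
  define l where "l = hmonom (hcoeff f d) d"
  define m where "m = hmonom (inverse (hcoeff f d)) (- d)"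
  have "m * l = 1"
    by (rule hahn_eqI)
       (use d(1) in \<open>auto simp: m_def l_def hcoeff_hmonom_mult one_hahn_def hcoeff_hmonom\<close>)
  then have "inverse l = m" by (metis inverse_unique mult.commute)
  moreover have "l \<in> H"
    unfolding l_def using hmonom_leading_in_trunc_core[OF H f d(2)] trunc_core_subset by blast
  ultimately have "m \<in> H" using H by (auto simp: is_subfield_def)
  then have m: "m \<in> trunc_core H"
    unfolding m_def by (rule hmonom_in_trunc_core) (use H in \<open>simp add: is_subfield_def\<close>)
  have "m \<noteq> 0" using \<open>m * l = 1\<close> by auto
  define a where "a = 1 - m * f"
  have a: "a \<in> trunc_core H"
    unfolding a_def by (intro trunc_core_minus trunc_core_mult H 1 m f)
  have "hcoeff a x = (if x = 0 then 1 else 0) - inverse (hcoeff f d) * hcoeff f (x + d)" for x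
    by (simp add: a_def m_def hcoeff_hmonom_mult one_hahn_def hcoeff_hmonom)
  then have "hcoeff a x = 0" if "x \<le> 0" for x
    using d(1) d(2)[of "x + d"] that by (cases "x = 0") auto
  then have small: "hsmall a" unfolding hsmall_def hsupp_def by (metis (mono_tags) greaterThan_iff mem_Collect_eq not_less subsetI)
  have "inverse (m * f) \<in> trunc_core H"
  proof (rule trunc_core_solution[where D = "\<lambda>z. z" and a = a and f = 1, OF H _ _ _ _ a small 1])
    fix b z assume b: "b \<in> H" "hsmall b" and z: "z - b * z \<in> H"
    \<comment> \<open>The constant coefficient shows that \<open>1 - b\<close> is a unit, so
      \<open>solve\<close> is division by \<open>1 - b\<close> in \<open>H\<close>.\<close>
    have "hcoeff (1 - b) 0 = 1"
      using b(2) by (auto simp: hsmall_def hsupp_def one_hahn_def hcoeff_hmonom)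
    then have "1 - b \<noteq> 0" by (metis hcoeff_zero zero_neq_one)
    then have "z = (z - b * z) * inverse (1 - b)" by (simp add: field_simps)
    moreover have "inverse (1 - b) \<in> H"
      using H b(1) is_subfield_minus[OF H] by (simp add: is_subfield_def)
    ultimately show "z \<in> H" using z H unfolding is_subfield_def by metis
  next
    show "inverse (m * f) - a * inverse (m * f) = 1"
      using False \<open>m \<noteq> 0\<close> by (simp add: a_def field_simps)
  qed simp_all
  then have "m * inverse (m * f) \<in> trunc_core H" by (intro trunc_core_mult H m)
  then show ?thesis using \<open>m \<noteq> 0\<close> by (simp add: field_simps)
qed (use f in simp)

lemma is_subfield_trunc_core:
  fixes H :: "('k::field, 'g::linordered_ab_group_add) hahn set"
  assumes "is_subfield H"
  shows "is_subfield (trunc_core H)"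
proof -
  have "1 \<in> trunc_core H"
    using hmonom_in_trunc_core[of 1 0 H] assms by (simp add: is_subfield_def one_hahn_def)
  moreover from this have "0 \<in> trunc_core H" using trunc_core_minus[OF assms, of 1 1] by simp
  ultimately show ?thesis
    unfolding is_subfield_def[of "trunc_core H"]
    by (intro conjI ballI trunc_core_add trunc_core_mult trunc_core_uminus trunc_core_inverse assms)
qed


section \<open>The resolvent hull\<close>

lemma htrunc_hderiv:
  assumes "derivation \<delta>"
  shows "htrunc (hderiv \<delta> c f) g = hderiv \<delta> c (htrunc f g)"
  by (rule hahn_eqI) (simp add: hcoeff_htrunc hcoeff_hderiv[OF assms] derivation_0[OF assms])

lemma hsupp_hderiv:
  assumes "derivation \<delta>"
  shows "hsupp (hderiv \<delta> c f) \<subseteq> hsupp f"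
  by (auto simp: hsupp_def hcoeff_hderiv[OF assms] derivation_0[OF assms])

lemma is_diff_subfield_trunc_core:
  assumes "derivation \<delta>" "is_diff_subfield (hderiv \<delta> c) H"
  shows "is_diff_subfield (hderiv \<delta> c) (trunc_core H)"
  using assms is_subfield_trunc_core
  by (auto simp: is_diff_subfield_def trunc_core_def htrunc_hderiv)

lemma resolvent_closed_trunc_core:
  assumes \<delta>: "derivation \<delta>" and H: "is_diff_subfield (hderiv \<delta> c) H"
    and res: "resolvent_closed (hderiv \<delta> c) H"
  shows "resolvent_closed (hderiv \<delta> c) (trunc_core H)"
  unfolding resolvent_closed_def
proof (intro ballI impI)
  let ?D = "hderiv \<delta> c"
  fix a f assume a: "a \<in> trunc_core H" "hsmall a" and f: "f \<in> trunc_core H"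
  note bij = bij_id_minus_hderiv[OF \<delta>]
  show "inv (id_minus ?D a) f \<in> trunc_core H"
  proof (rule trunc_core_solution[where D = ?D, OF _ _ htrunc_hderiv[OF \<delta>] hsupp_hderiv[OF \<delta>] _ a f])
    fix b z assume b: "b \<in> H" "hsmall b" and z: "z - b * ?D z \<in> H"
    \<comment> \<open>Injectivity identifies \<open>z\<close> with the resolvent of
      \<open>z - b * ?D z\<close>, so resolvent closedness of \<open>H\<close> provides
      \<open>solve\<close>.\<close>
    have "inv (id_minus ?D b) (id_minus ?D b z) = z"
      using bij[OF b(2)] by (simp add: bij_is_inj)
    then show "z \<in> H" using res b z unfolding resolvent_closed_def id_minus_def by metis
  next
    show "inv (id_minus ?D a) f - a * ?D (inv (id_minus ?D a) f) = f"
      using bij_inv_eq_iff[OF bij[OF a(2)]] by (metis id_minus_def)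
  qed (use H in \<open>simp_all add: is_diff_subfield_def\<close>)
qed

theorem mainTheorem3:
  fixes \<delta> :: "'k::field_char_0 \<Rightarrow> 'k"
    and c :: "'g::linordered_ab_group_add \<Rightarrow> 'k"
    and E :: "('k, 'g) hahn set"
  assumes "derivation \<delta>"
    and "Modules.additive c"
    and "is_diff_subfield (hderiv \<delta> c) E"
    and "trunc_closed E"
  shows "trunc_closed (resolvent_hull (hderiv \<delta> c) E)"
proof -
  let ?H = "resolvent_hull (hderiv \<delta> c) E"
  note hull = resolvent_hull_least[where D = "hderiv \<delta> c" and E = E]
  have "E \<subseteq> trunc_core ?H"
    using hull(3) assms(4) by (auto simp: trunc_core_def trunc_closed_def)
  \<comment> \<open>Minimality forces the hull to coincide with its core.\<close>
  then have "?H \<subseteq> trunc_core ?H"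
    by (intro hull(4) is_diff_subfield_trunc_core resolvent_closed_trunc_core assms(1) hull(1,2))
  then show ?thesis by (auto simp: trunc_core_def trunc_closed_def)
qed

end
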